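(* Let $0<s<1$ and $\mathbb{R}^n_+=\{x=(x',x_n)\in\mathbb{R}^n : x_n>0\}$. Let $g:\mathbb{R}\to\mathbb{R}$ be continuous and monotone decreasing (i.e. $g(a)\ge g(b)$ whenever $a\le b$). Let $u\in\mathcal{L}_{2s}\cap C^2(\mathbb{R}^n_+)\cap C(\overline{\mathbb{R}^n_+})$ be a nonnegative bounded solution of $$\begin{cases}(-\Delta)^s u(x)-\Delta u(x)=g(u(x)), & x\in\mathbb{R}^n_+,\\ u(x)>0, & x\in\mathbb{R}^n_+,\\ u(x)=0, & x\in\mathbb{R}^n\setminus\mathbb{R}^n_+.\end{cases}$$ Then $u(x)$ is strictly increasing with respect to $x_n$ in $\mathbb{R}^n_+$.
   Context: Points of $\mathbb{R}^n$ are written $x=(x',x_n)$ with $x'\in\mathbb{R}^{n-1}$. The space $\mathcal{L}_{2s}$ is $$\mathcal{L}_{2s}=\Big\{u\in L^1_{loc}(\mathbb{R}^n)\ \Big|\ \int_{\mathbb{R}^n}\frac{|u(x)|}{1+|x|^{n+2s}}\,dx<+\infty\Big\}.$$ The fractional Laplacian is $$(-\Delta)^s u(x)=C_{n,s}\,\mathrm{P.V.}\int_{\mathbb{R}^n}\frac{u(x)-u(y)}{|x-y|^{n+2s}}\,dy=C_{n,s}\lim_{\epsilon\to0}\int_{\mathbb{R}^n\setminus B_\epsilon(x)}\frac{u(x)-u(y)}{|x-y|^{n+2s}}\,dy,$$ where $C_{n,s}>0$ is the usual normalization constant. $\Delta$ is the classical Laplacian. *)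

theory Defs
  imports "HOL-Analysis.Analysis"
begin

text \<open>
  \<open>\<real>\<^sup>n\<close> is \<^typ>\<open>real^'n\<close> with \<open>n = CARD('n)\<close>. An index type carries no order, so the
  coordinate written \<open>x\<^sub>n\<close> in the mathematics is singled out by an arbitrary index \<open>k\<close>.
\<close>

definition half_space :: "'n::finite \<Rightarrow> (real^'n) set" where
  "half_space k = {x. 0 < x $ k}"

text \<open>
  The space \<open>L\<^sub>2\<^sub>s\<close>; absolute integrability on every compact set is membership in \<open>L\<^sup>1\<^sub>l\<^sub>o\<^sub>c\<close>.
\<close>

definition L2s_space :: "real \<Rightarrow> (real^'n::finite \<Rightarrow> real) set" where
  "L2s_space s = {u.
     (\<forall>K. compact K \<longrightarrow> u absolutely_integrable_on K) \<and>
     integrable lebesgue (\<lambda>x. \<bar>u x\<bar> / (1 + norm x powr (real CARD('n) + 2 * s)))}"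

text \<open>
  \<open>C\<^sup>2\<close> on an open set, via Frechet derivatives of first and second order in the spaces of
  bounded linear maps.
\<close>

definition C2_on :: "('a::real_normed_vector) set \<Rightarrow> ('a \<Rightarrow> real) \<Rightarrow> bool" where
  "C2_on S u \<longleftrightarrow>
     (\<exists>(D :: 'a \<Rightarrow> 'a \<Rightarrow>\<^sub>L real) (D2 :: 'a \<Rightarrow> 'a \<Rightarrow>\<^sub>L 'a \<Rightarrow>\<^sub>L real).
        (\<forall>x\<in>S. (u has_derivative blinfun_apply (D x)) (at x)) \<and>
        (\<forall>x\<in>S. (D has_derivative blinfun_apply (D2 x)) (at x)) \<and>
        continuous_on S D2)"

definition partial_deriv :: "'n::finite \<Rightarrow> (real^'n \<Rightarrow> real) \<Rightarrow> real^'n \<Rightarrow> real" where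
  "partial_deriv i u x = deriv (\<lambda>t. u (x + t *\<^sub>R axis i 1)) 0"

definition laplacian :: "(real^'n::finite \<Rightarrow> real) \<Rightarrow> real^'n \<Rightarrow> real" where
  "laplacian u x = (\<Sum>i\<in>UNIV. partial_deriv i (partial_deriv i u) x)"

text \<open>
  The constant that makes \<open>\<bar>\<xi>\<bar>\<^sup>2\<^sup>s\<close> the Fourier symbol of the fractional Laplacian, for \<open>0 < s < 1\<close>:
  \<open>4\<^sup>s \<Gamma>(n/2 + s) / (\<pi>\<^sup>n\<^sup>/\<^sup>2 \<bar>\<Gamma>(-s)\<bar>)\<close>.
\<close>

definition frac_laplacian_const :: "nat \<Rightarrow> real \<Rightarrow> real" where
  "frac_laplacian_const n s =
     4 powr s * Gamma (real n / 2 + s) / (pi powr (real n / 2) * \<bar>Gamma (- s)\<bar>)"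

text \<open>
  \<open>has_frac_laplacian s u x L\<close> states that the principal value defining \<open>(-\<Delta>)\<^sup>s u(x)\<close> exists and
  equals \<open>L\<close>. The integrability clause excludes the default value that the library assigns to the
  integral of a non-integrable function; it holds for every \<open>u\<close> in \<open>L\<^sub>2\<^sub>s\<close>.
\<close>

definition has_frac_laplacian ::
    "real \<Rightarrow> (real^'n::finite \<Rightarrow> real) \<Rightarrow> real^'n \<Rightarrow> real \<Rightarrow> bool" where
  "has_frac_laplacian s u x L \<longleftrightarrow>
     (\<forall>\<epsilon>>0. set_integrable lebesgue (UNIV - ball x \<epsilon>)
        (\<lambda>y. (u x - u y) / norm (x - y) powr (real CARD('n) + 2 * s))) \<and>
     ((\<lambda>\<epsilon>. frac_laplacian_const CARD('n) s *
        (LINT y : UNIV - ball x \<epsilon> | lebesgue.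
           (u x - u y) / norm (x - y) powr (real CARD('n) + 2 * s))) \<longlongrightarrow> L) (at_right 0)"

end

theory Submission
  imports Defs
begin

text \<open>
  Let \<open>e\<close> be the unit vector in direction \<open>k\<close>, fix \<open>\<tau> > 0\<close> and put \<open>w x = u (x + \<tau> e) - u x\<close>. Because
  \<open>g\<close> is decreasing on the whole line, the difference of the two equations says that
  \<open>(-\<Delta>)\<^sup>s w - \<Delta> w\<close> is nonnegative at every point of the half space where \<open>w \<le> 0\<close>, whatever the size of
  \<open>\<tau>\<close>; and \<open>w\<close> is nonnegative outside the half space, because \<open>u\<close> vanishes there. The theorem is
  therefore a maximum principle for \<open>w\<close>, for each \<open>\<tau>\<close> separately.

  The weak form, \<open>w \<ge> 0\<close>, is \<open>shift_difference_nonneg\<close>. The difficulty is that a negative infimum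
  \<open>-M\<close> may be approached only at infinity, possibly ever farther from the complement of the half
  space. Take an almost minimal point \<open>p\<close> and a scale \<open>R \<ge> 1\<close> not smaller than the height of \<open>p\<close> above
  the boundary. Adding the paraboloid \<open>\<eta> |y - p|\<^sup>2 / R\<^sup>2\<close> produces a global minimum \<open>q\<close> within distance
  \<open>R\<close> of \<open>p\<close> (\<open>perturbed_minimum\<close>). There \<open>\<Delta> w q \<ge> - 2 n \<eta> / R\<^sup>2\<close>. On the other hand the part of the
  complement at distance of order \<open>R\<close> from \<open>q\<close> pulls \<open>(-\<Delta>)\<^sup>s w q\<close> down by a multiple of \<open>M / R\<^sup>2\<^sup>s\<close>,
  whereas the paraboloid can raise it only by a multiple of \<open>\<eta> / R\<^sup>2\<^sup>s\<close>
  (\<open>frac_laplacian_le_at_perturbed_minimum\<close>). As \<open>R \<ge> 1\<close> and \<open>s < 1\<close>, also \<open>1 / R\<^sup>2 \<le> 1 / R\<^sup>2\<^sup>s\<close>, and the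
  two bounds contradict each other for \<open>\<eta>\<close> small compared with \<open>M\<close>, uniformly in \<open>p\<close> and \<open>R\<close>.

  The strong form, \<open>w > 0\<close> in the half space, is \<open>shift_difference_pos\<close>: at an interior zero of
  \<open>w \<ge> 0\<close> the equation gives \<open>(-\<Delta>)\<^sup>s w \<ge> \<Delta> w \<ge> 0\<close>, but \<open>w\<close> is positive on a strip below the boundary, so
  the defining integral is strictly negative.
\<close>

section \<open>Integrals of the kernel\<close>

text \<open>
  The singular kernel and its tail are estimated without polar coordinates: a function that is at
  most \<open>c j\<close> on the \<open>j\<close>-th dyadic annulus is dominated by \<open>\<Sum>j. c j * indicator (ball x (r j))\<close>, and
  the volumes of balls are known. Enlarging annuli to balls costs only a constant factor.
\<close>

lemma integral_le_ball_series:
  fixes f :: "'a::euclidean_space \<Rightarrow> real" and c r :: "nat \<Rightarrow> real"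
  assumes meas: "f \<in> borel_measurable borel"
    and nonneg: "\<And>y. 0 \<le> f y" "\<And>j. 0 \<le> c j" "\<And>j. 0 \<le> r j"
    and cover: "\<And>y. f y \<noteq> 0 \<Longrightarrow> \<exists>j. dist x y < r j \<and> f y \<le> c j"
    and sums: "(\<lambda>j. c j * r j ^ DIM('a)) sums S"
  shows "integrable lborel f" and "integral\<^sup>L lborel f \<le> unit_ball_vol DIM('a) * S"
proof -
  let ?V = "unit_ball_vol (real DIM('a))"
  have [measurable]: "ball x (r j) \<in> sets borel" for j
    by simp
  have S: "0 \<le> S"
    using sums_le[OF _ sums_zero sums] nonneg by simp
  have sums': "(\<lambda>j. ?V * (c j * r j ^ DIM('a))) sums (?V * S)"
    by (intro sums_mult sums)
  have "(\<integral>\<^sup>+y. ennreal (f y) \<partial>lborel)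
      \<le> (\<integral>\<^sup>+y. (\<Sum>j. ennreal (c j) * indicator (ball x (r j)) y) \<partial>lborel)"
  proof (rule nn_integral_mono)
    fix y
    define G where "G = (\<lambda>j. ennreal (c j) * indicator (ball x (r j)) y)"
    show "ennreal (f y) \<le> (\<Sum>j. ennreal (c j) * indicator (ball x (r j)) y)"
    proof (cases "f y = 0")
      case False
      then obtain j where j: "dist x y < r j" "f y \<le> c j"
        using cover by blast
      have "ennreal (f y) \<le> G j"
        using j by (simp add: G_def ennreal_leI)
      also have "\<dots> = sum G {j}"
        by simp
      also have "\<dots> \<le> suminf G"
        by (rule sum_le_suminf) auto
      finally show ?thesis
        by (simp add: G_def)
    qed simp
  qed
  also have "\<dots> = (\<Sum>j. \<integral>\<^sup>+y. ennreal (c j) * indicator (ball x (r j)) y \<partial>lborel)"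
    by (rule nn_integral_suminf) measurable
  also have "\<dots> = (\<Sum>j. ennreal (?V * (c j * r j ^ DIM('a))))"
    using nonneg
    by (intro suminf_cong)
       (simp add: nn_integral_cmult_indicator emeasure_ball ennreal_mult[symmetric] mult_ac)
  also have "\<dots> = ennreal (?V * S)"
    using sums' nonneg by (subst suminf_ennreal_eq[where x="?V * S"]) auto
  finally have le: "(\<integral>\<^sup>+y. ennreal (f y) \<partial>lborel) \<le> ennreal (?V * S)" .
  show int: "integrable lborel f"
  proof (rule integrableI_bounded)
    show "(\<integral>\<^sup>+y. ennreal (norm (f y)) \<partial>lborel) < \<infinity>"
      using le nonneg(1) by (auto intro: le_less_trans)
  qed (use meas in simp)
  show "integral\<^sup>L lborel f \<le> ?V * S"
    using le nonneg(1) S nn_integral_eq_integral[OF int]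
    by (simp add: ennreal_le_iff)
qed

lemma dyadic_scale:
  fixes a :: real
  assumes "1 \<le> a"
  shows "\<exists>j::nat. 2 ^ j \<le> a \<and> a < 2 * 2 ^ j"
proof -
  define N where "N = (LEAST n::nat. a < 2 ^ n)"
  have ex: "\<exists>n::nat. a < 2 ^ n"
    using real_arch_pow[of 2 a] by simp
  then have N: "a < 2 ^ N"
    unfolding N_def by (rule LeastI_ex)
  then have "N \<noteq> 0"
    using assms by (cases N) auto
  then obtain j where j: "N = Suc j"
    using not0_implies_Suc by blast
  then have "\<not> a < 2 ^ j"
    unfolding N_def using not_less_Least[of j "\<lambda>n. a < 2 ^ n"] by auto
  then show ?thesis
    using N j by (auto intro!: exI[of _ j])
qed

text \<open>
  The constant must not depend on the radius: both this lemma and the next record the scaling in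
  \<open>\<rho>\<close>, so that all nonlocal terms of the final comparison carry the same power of the length scale.
\<close>

lemma kernel_integral_outside_ball:
  fixes s :: real
  assumes s: "0 < s"
  shows "\<exists>C>0. \<forall>(x::real^'n::finite) \<rho>. 0 < \<rho> \<longrightarrow>
     integrable lborel (\<lambda>y. indicator (- ball x \<rho>) y / norm (x - y) powr (CARD('n) + 2 * s)) \<and>
     (\<integral>y. indicator (- ball x \<rho>) y / norm (x - y) powr (CARD('n) + 2 * s) \<partial>lborel)
       \<le> C * \<rho> powr (- 2 * s)"
proof -
  let ?n = "CARD('n)"
  let ?p = "real ?n + 2 * s"
  let ?C = "unit_ball_vol ?n * (2 ^ ?n / (1 - 2 powr (- 2 * s)))"
  have q: "2 powr (- 2 * s) < (1::real)"
    using s by (simp add: powr_less_one)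
  have *: "integrable lborel (\<lambda>y. indicator (- ball x \<rho>) y / norm (x - y) powr ?p) \<and>
     (\<integral>y. indicator (- ball x \<rho>) y / norm (x - y) powr ?p \<partial>lborel) \<le> ?C * \<rho> powr (- 2 * s)"
    if \<rho>: "0 < \<rho>" for x :: "real^'n" and \<rho> :: real
  proof -
    define f where "f = (\<lambda>y. indicator (- ball x \<rho>) y / norm (x - y) powr ?p)"
    define t where "t = (\<lambda>j. 2 ^ j * \<rho>)"
    have t: "0 < t j" for j
      using \<rho> by (simp add: t_def)
    have cover: "\<exists>j. dist x y < 2 * t j \<and> f y \<le> t j powr (- ?p)" if "f y \<noteq> 0" for y
    proof -
      have d: "\<rho> \<le> dist x y"
        using that by (auto simp: f_def indicator_def split: if_splits)
      obtain j where j: "2 ^ j \<le> dist x y / \<rho>" "dist x y / \<rho> < 2 * 2 ^ j"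
        using dyadic_scale[of "dist x y / \<rho>"] d \<rho> by auto
      have "t j \<le> dist x y" "dist x y < 2 * t j"
        using j \<rho> by (auto simp: t_def field_simps)
      moreover have "f y = 1 / dist x y powr ?p"
        using d by (simp add: f_def dist_norm)
      then have "f y = dist x y powr (- ?p)"
        by (simp only: powr_minus_divide)
      ultimately show ?thesis
        using t[of j] s by (auto intro!: exI[of _ j] powr_mono2')
    qed
    \<comment> \<open>the kernel exponent exceeds the volume exponent by \<open>2 * s\<close>: a geometric series in \<open>j\<close>\<close>
    have eq: "t j powr (- ?p) * (2 * t j) ^ ?n = 2 ^ ?n * \<rho> powr (- 2 * s) * (2 powr (- 2 * s)) ^ j" for j
    proof -
      have "t j powr (- ?p) * t j ^ ?n = t j powr (- ?p) * t j powr ?n"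
        using t[of j] by (simp add: powr_realpow)
      also have "\<dots> = t j powr (- 2 * s)"
        by (simp add: powr_add[symmetric])
      also have "\<dots> = \<rho> powr (- 2 * s) * (2 powr (- 2 * s)) ^ j"
        using \<rho> by (simp add: t_def powr_mult powr_realpow[symmetric] powr_powr mult_ac)
      finally show ?thesis
        by (simp add: power_mult_distrib mult_ac)
    qed
    have sums: "(\<lambda>j. t j powr (- ?p) * (2 * t j) ^ DIM(real^'n)) sums
        (2 ^ ?n * \<rho> powr (- 2 * s) * (1 / (1 - 2 powr (- 2 * s))))"
      using q unfolding DIM_cart DIM_real mult_1_right eq
      by (intro sums_mult geometric_sums) auto
    have "f \<in> borel_measurable borel"
      unfolding f_def by measurable
    then have "integrable lborel f"
       "integral\<^sup>L lborel f \<le> unit_ball_vol DIM(real^'n) * (2 ^ ?n * \<rho> powr (- 2 * s) * (1 / (1 - 2 powr (- 2 * s))))"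
      using integral_le_ball_series[of f "\<lambda>j. t j powr (- ?p)" "\<lambda>j. 2 * t j" x, OF _ _ _ _ cover sums] t
      by (auto simp: f_def less_imp_le)
    then show ?thesis
      by (simp add: f_def mult_ac)
  qed
  have "?C > 0"
    using q by (intro mult_pos_pos divide_pos_pos) auto
  then show ?thesis
    using * by blast
qed

lemma powr_half:
  fixes t p :: real
  shows "0 \<le> t \<Longrightarrow> (t / 2) powr (- p) = 2 powr p * t powr (- p)"
  by (simp add: powr_divide powr_minus field_simps)

text \<open>
  The factor \<open>(norm (x - y))\<^sup>2\<close> is what a paraboloid leaves at its touching point once the linear
  part has cancelled; it makes the kernel integrable at \<open>x\<close> because \<open>2 * s < 2\<close>.
\<close>

lemma kernel_integral_inside_ball:
  fixes s :: real
  assumes s: "0 < s" "s < 1"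
  shows "\<exists>C>0. \<forall>(x::real^'n::finite) \<rho>. 0 < \<rho> \<longrightarrow>
     integrable lborel (\<lambda>y. indicator (ball x \<rho>) y * (norm (x - y))\<^sup>2 / norm (x - y) powr (CARD('n) + 2 * s)) \<and>
     (\<integral>y. indicator (ball x \<rho>) y * (norm (x - y))\<^sup>2 / norm (x - y) powr (CARD('n) + 2 * s) \<partial>lborel)
       \<le> C * \<rho> powr (2 - 2 * s)"
proof -
  let ?n = "CARD('n)"
  let ?p = "real ?n + 2 * s"
  let ?C = "unit_ball_vol ?n * (2 powr ?p * 2 ^ ?n / (1 - 2 powr (2 * s - 2)))"
  have q: "2 powr (2 * s - 2) < (1::real)"
    using s by (simp add: powr_less_one)
  have *: "integrable lborel (\<lambda>y. indicator (ball x \<rho>) y * (norm (x - y))\<^sup>2 / norm (x - y) powr ?p) \<and>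
     (\<integral>y. indicator (ball x \<rho>) y * (norm (x - y))\<^sup>2 / norm (x - y) powr ?p \<partial>lborel)
       \<le> ?C * \<rho> powr (2 - 2 * s)"
    if \<rho>: "0 < \<rho>" for x :: "real^'n" and \<rho> :: real
  proof -
    define f where "f = (\<lambda>y. indicator (ball x \<rho>) y * (norm (x - y))\<^sup>2 / norm (x - y) powr ?p)"
    define t where "t = (\<lambda>j. \<rho> / 2 ^ j)"
    define c where "c = (\<lambda>j. (t j)\<^sup>2 * (t j / 2) powr (- ?p))"
    have t: "0 < t j" for j
      using \<rho> by (simp add: t_def)
    have cover: "\<exists>j. dist x y < 2 * t j \<and> f y \<le> c j" if "f y \<noteq> 0" for y
    proof -
      have d: "dist x y < \<rho>" "0 < dist x y"
        using that by (auto simp: f_def indicator_def split: if_splits)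
      obtain j where j: "2 ^ j \<le> \<rho> / dist x y" "\<rho> / dist x y < 2 * 2 ^ j"
        using dyadic_scale[of "\<rho> / dist x y"] d \<rho> by auto
      have td: "t j / 2 \<le> dist x y" "dist x y \<le> t j"
        using j \<rho> d by (auto simp: t_def field_simps)
      moreover have "f y = (dist x y)\<^sup>2 * (1 / dist x y powr ?p)"
        using d by (simp add: f_def dist_norm)
      then have "f y = (dist x y)\<^sup>2 * dist x y powr (- ?p)"
        by (simp only: powr_minus_divide)
      moreover have "\<dots> \<le> c j"
        unfolding c_def using td t[of j] s by (intro mult_mono power_mono powr_mono2') auto
      ultimately show ?thesis
        using t[of j] by (intro exI[of _ j]) auto
    qed
    have eq: "c j * (2 * t j) ^ ?n
        = 2 powr ?p * 2 ^ ?n * \<rho> powr (2 - 2 * s) * (2 powr (2 * s - 2)) ^ j" for j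
    proof -
      have half: "(t j / 2) powr (- ?p) = 2 powr ?p * t j powr (- ?p)"
        using t[of j] by (intro powr_half less_imp_le)
      have "c j * (2 * t j) ^ ?n = 2 powr ?p * 2 ^ ?n * ((t j)\<^sup>2 * t j powr (- ?p) * t j ^ ?n)"
        unfolding c_def half by (simp only: power_mult_distrib mult_ac)
      also have "(t j)\<^sup>2 * (t j powr (- ?p)) * t j ^ ?n = t j powr 2 * t j powr (- ?p) * t j powr ?n"
        using t[of j] by (simp add: powr_realpow)
      also have "\<dots> = t j powr (2 - 2 * s)"
        by (simp add: powr_add[symmetric])
      also have "\<dots> = \<rho> powr (2 - 2 * s) * (2 powr (2 * s - 2)) ^ j"
      proof -
        have "t j = \<rho> * 2 powr (- real j)"
          by (simp add: t_def powr_minus powr_realpow divide_inverse)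
        then have "t j powr (2 - 2 * s) = \<rho> powr (2 - 2 * s) * (2 powr (2 * s - 2)) powr real j"
          using \<rho> by (simp add: powr_mult powr_powr algebra_simps)
        then show ?thesis
          by (simp add: powr_realpow)
      qed
      finally show ?thesis
        by (simp only: mult_ac)
    qed
    have sums: "(\<lambda>j. c j * (2 * t j) ^ DIM(real^'n)) sums
        (2 powr ?p * 2 ^ ?n * \<rho> powr (2 - 2 * s) * (1 / (1 - 2 powr (2 * s - 2))))"
      using q unfolding DIM_cart DIM_real mult_1_right eq
      by (intro sums_mult geometric_sums) auto
    have [measurable]: "ball x \<rho> \<in> sets borel"
      by simp
    have "f \<in> borel_measurable borel"
      unfolding f_def by measurable
    then have "integrable lborel f" "integral\<^sup>L lborel f \<le> unit_ball_vol DIM(real^'n) *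
        (2 powr ?p * 2 ^ ?n * \<rho> powr (2 - 2 * s) * (1 / (1 - 2 powr (2 * s - 2))))"
      using integral_le_ball_series[of f c "\<lambda>j. 2 * t j" x, OF _ _ _ _ cover sums] t
      by (auto simp: f_def c_def less_imp_le)
    then show ?thesis
      by (simp add: f_def mult_ac)
  qed
  have "?C > 0"
    using q by (intro mult_pos_pos divide_pos_pos) auto
  then show ?thesis
    using * by blast
qed

section \<open>The principal value\<close>

lemma frac_laplacian_const_pos:
  assumes "0 < s" "s < 1" "0 < n"
  shows "0 < frac_laplacian_const n s"
proof -
  have "- s \<notin> \<int>\<^sub>\<le>\<^sub>0"
  proof
    assume "- s \<in> \<int>\<^sub>\<le>\<^sub>0"
    then obtain m where m: "- s = real_of_int m"
      by (auto elim: nonpos_Ints_cases)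
    then have "real_of_int (- 1) < real_of_int m" "real_of_int m < real_of_int 0"
      using assms by auto
    then show False
      unfolding of_int_less_iff by linarith
  qed
  then have "Gamma (- s) \<noteq> 0"
    by (simp add: Gamma_eq_zero_iff)
  moreover have "0 < Gamma (real n / 2 + s)"
    using assms by (intro Gamma_real_pos) auto
  ultimately show ?thesis
    by (simp add: frac_laplacian_const_def)
qed

lemma lborel_integral_translate:
  fixes f :: "'a::euclidean_space \<Rightarrow> real"
  assumes "f \<in> borel_measurable borel"
  shows "integrable lborel (\<lambda>y. f (c + y)) \<longleftrightarrow> integrable lborel f"
    and "(\<integral>y. f (c + y) \<partial>lborel) = integral\<^sup>L lborel f"
proof -
  have d: "distr lborel borel ((+) c) = (lborel :: 'a measure)"
    by (rule lborel_distr_plus)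
  show "integrable lborel (\<lambda>y. f (c + y)) \<longleftrightarrow> integrable lborel f"
    using integrable_distr_eq[of "(+) c" lborel borel f] assms by (simp add: d)
  show "(\<integral>y. f (c + y) \<partial>lborel) = integral\<^sup>L lborel f"
    using integral_distr[of "(+) c" lborel borel f] assms by (simp add: d)
qed

text \<open>
  This symmetry about \<open>x\<close> is what the principal value exploits: linear terms integrate to zero over
  every annulus centred at \<open>x\<close>.
\<close>

lemma lborel_integral_odd_eq_0:
  fixes f :: "'a::euclidean_space \<Rightarrow> real"
  assumes "f \<in> borel_measurable borel" and odd: "\<And>y. f (2 *\<^sub>R x - y) = - f y"
  shows "integral\<^sup>L lborel f = 0"
proof -
  let ?T = "\<lambda>y. 2 *\<^sub>R x + (-1) *\<^sub>R y"
  have d: "lborel = distr lborel borel ?T"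
    using lborel_affine[of "-1" "2 *\<^sub>R x"] by (simp add: density_1)
  have "integral\<^sup>L lborel f = (\<integral>y. f (?T y) \<partial>lborel)"
    using integral_distr[of ?T lborel borel f] assms(1) d by simp
  then show ?thesis
    by (simp add: odd)
qed

definition frac_diff :: "real \<Rightarrow> (real^'n::finite \<Rightarrow> real) \<Rightarrow> real^'n \<Rightarrow> real^'n \<Rightarrow> real" where
  "frac_diff s u x y = (u x - u y) / norm (x - y) powr (real CARD('n) + 2 * s)"

lemma borel_measurable_frac_diff:
  fixes u :: "real^'n::finite \<Rightarrow> real"
  assumes [measurable]: "u \<in> borel_measurable borel"
  shows "frac_diff s u x \<in> borel_measurable borel"
  unfolding frac_diff_def[abs_def] by measurable

text \<open>
  Translation and reflection of integrals are simplest for Borel functions and \<^const>\<open>lborel\<close>, and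
  the passage to its completion changes neither integrability nor integrals.
\<close>

lemma has_frac_laplacian_lborel:
  fixes u :: "real^'n::finite \<Rightarrow> real"
  assumes u: "u \<in> borel_measurable borel"
  shows "has_frac_laplacian s u x L \<longleftrightarrow>
     (\<forall>\<epsilon>>0. integrable lborel (\<lambda>y. indicator (- ball x \<epsilon>) y * frac_diff s u x y)) \<and>
     ((\<lambda>\<epsilon>. frac_laplacian_const CARD('n) s *
        (\<integral>y. indicator (- ball x \<epsilon>) y * frac_diff s u x y \<partial>lborel)) \<longlongrightarrow> L) (at_right 0)"
proof -
  have [measurable]: "frac_diff s u x \<in> borel_measurable borel"
    by (rule borel_measurable_frac_diff[OF u])
  have "(\<lambda>y. indicator (- ball x \<epsilon>) y * frac_diff s u x y) \<in> lborel \<rightarrow>\<^sub>M borel" for \<epsilon>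
    by measurable
  then show ?thesis
    unfolding has_frac_laplacian_def set_integrable_def set_lebesgue_integral_def
      frac_diff_def[symmetric] Compl_eq_Diff_UNIV[symmetric]
    by (simp add: integrable_completion integral_completion)
qed

lemma has_frac_laplacian_translate:
  fixes u :: "real^'n::finite \<Rightarrow> real"
  assumes u: "u \<in> borel_measurable borel"
    and L: "has_frac_laplacian s u (c + x) L"
  shows "has_frac_laplacian s (\<lambda>y. u (c + y)) x L"
proof -
  have [measurable]: "frac_diff s u (c + x) \<in> borel_measurable borel"
    by (rule borel_measurable_frac_diff[OF u])
  have m: "(\<lambda>y. u (c + y)) \<in> borel_measurable borel"
    using u by measurable
  define F where "F = (\<lambda>\<epsilon> y. indicator (- ball (c + x) \<epsilon>) y * frac_diff s u (c + x) y)"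
  have F: "F \<epsilon> \<in> borel_measurable borel" for \<epsilon>
    unfolding F_def by measurable
  have eq: "indicator (- ball x \<epsilon>) y * frac_diff s (\<lambda>y. u (c + y)) x y = F \<epsilon> (c + y)" for \<epsilon> y
    by (simp add: F_def frac_diff_def indicator_def dist_norm)
  have eq': "(\<lambda>y. indicator (- ball (c + x) \<epsilon>) y * frac_diff s u (c + x) y) = F \<epsilon>" for \<epsilon>
    by (simp add: F_def)
  show ?thesis
    using L unfolding has_frac_laplacian_lborel[OF u] has_frac_laplacian_lborel[OF m] eq eq'
    by (simp add: lborel_integral_translate[OF F])
qed

lemma has_frac_laplacian_diff:
  fixes u v :: "real^'n::finite \<Rightarrow> real"
  assumes u: "u \<in> borel_measurable borel" and v: "v \<in> borel_measurable borel"
    and L: "has_frac_laplacian s u x L" and M: "has_frac_laplacian s v x M"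
  shows "has_frac_laplacian s (\<lambda>y. u y - v y) x (L - M)"
proof -
  let ?I = "\<lambda>\<epsilon>. indicator (- ball x \<epsilon>)"
  have m: "(\<lambda>y. u y - v y) \<in> borel_measurable borel"
    using u v by measurable
  have eq: "?I \<epsilon> y * frac_diff s (\<lambda>y. u y - v y) x y
      = ?I \<epsilon> y * frac_diff s u x y - ?I \<epsilon> y * frac_diff s v x y" for \<epsilon> y
  proof -
    have "frac_diff s (\<lambda>y. u y - v y) x y = frac_diff s u x y - frac_diff s v x y"
      by (simp add: frac_diff_def diff_divide_distrib)
    then show ?thesis
      by (simp only: right_diff_distrib)
  qed
  note L = L[unfolded has_frac_laplacian_lborel[OF u]]
  note M = M[unfolded has_frac_laplacian_lborel[OF v]]
  let ?c = "frac_laplacian_const CARD('n) s"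
  have "((\<lambda>\<epsilon>. ?c * (\<integral>y. ?I \<epsilon> y * frac_diff s u x y \<partial>lborel)
        - ?c * (\<integral>y. ?I \<epsilon> y * frac_diff s v x y \<partial>lborel)) \<longlongrightarrow> L - M) (at_right 0)"
    using L M by (intro tendsto_diff) auto
  moreover have "eventually (\<lambda>\<epsilon>::real. 0 < \<epsilon>) (at_right 0)"
    by (rule eventually_at_right_less)
  ultimately have "((\<lambda>\<epsilon>. ?c * (\<integral>y. ?I \<epsilon> y * frac_diff s u x y - ?I \<epsilon> y * frac_diff s v x y \<partial>lborel))
       \<longlongrightarrow> L - M) (at_right 0)"
    using L M by (elim Lim_transform_eventually eventually_mono)
      (simp add: right_diff_distrib Bochner_Integration.integral_diff)
  then show ?thesis
    unfolding has_frac_laplacian_lborel[OF m] eq using L M by auto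
qed

text \<open>
  A one-sided bound of the difference quotient bounds the principal value. The linear term \<open>b\<close>
  may fail to be integrable at \<open>x\<close>, but each truncated integral of it vanishes by oddness; the
  nonnegative error \<open>P\<close> is simply integrated over the whole space. The gain \<open>N\<close> has to stay away from
  \<open>x\<close> so that small truncations do not lose any of it.
\<close>

lemma has_frac_laplacian_upper_bound:
  fixes w :: "real^'n::finite \<Rightarrow> real"
  assumes w: "w \<in> borel_measurable borel" and L: "has_frac_laplacian s w x L"
    and s: "0 < s" and c: "0 < frac_laplacian_const CARD('n) s"
    and \<rho>: "0 < \<rho>"
    and int: "integrable lborel P" "integrable lborel N" and P: "\<And>y. 0 \<le> P y"
    and N: "\<And>y. y \<in> ball x \<rho> \<Longrightarrow> N y = 0"
    and le: "\<And>y. frac_diff s w x y \<le>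
       indicator (ball x \<rho>) y * ((y - x) \<bullet> b) / norm (x - y) powr (real CARD('n) + 2 * s) + P y - N y"
  shows "L \<le> frac_laplacian_const CARD('n) s * (integral\<^sup>L lborel P - integral\<^sup>L lborel N)"
proof -
  let ?c = "frac_laplacian_const CARD('n) s"
  let ?I = "\<lambda>\<epsilon>. indicator (- ball x \<epsilon>) :: real^'n \<Rightarrow> real"
  define lin where "lin = (\<lambda>\<epsilon> y. ?I \<epsilon> y * (indicator (ball x \<rho>) y * ((y - x) \<bullet> b)
      / norm (x - y) powr (real CARD('n) + 2 * s)))"
  have [measurable]: "ball x r \<in> sets borel" for r
    by simp
  have linm: "lin \<epsilon> \<in> borel_measurable borel" for \<epsilon>
    unfolding lin_def by measurable
  have lin0: "integral\<^sup>L lborel (lin \<epsilon>) = 0" for \<epsilon>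
  proof (rule lborel_integral_odd_eq_0[where x = x, OF linm])
    fix y
    have "dist x (2 *\<^sub>R x - y) = dist x y" "norm (x - (2 *\<^sub>R x - y)) = norm (x - y)"
      by (simp_all add: dist_norm scaleR_2 norm_minus_commute)
    moreover have "(2 *\<^sub>R x - y - x) \<bullet> b = - ((y - x) \<bullet> b)"
      by (simp add: scaleR_2 inner_diff_left)
    ultimately show "lin \<epsilon> (2 *\<^sub>R x - y) = - lin \<epsilon> y"
      by (simp add: lin_def indicator_def)
  qed
  \<comment> \<open>after truncation at \<open>\<epsilon>\<close> the linear term is dominated by a multiple of the tail of the kernel\<close>
  have linint: "integrable lborel (lin \<epsilon>)" if \<epsilon>: "0 < \<epsilon>" for \<epsilon>
  proof (rule Bochner_Integration.integrable_bound)
    show "integrable lborel (\<lambda>y. \<rho> * norm b * (?I \<epsilon> y / norm (x - y) powr (real CARD('n) + 2 * s)))"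
      using kernel_integral_outside_ball[where ?'n = 'n, OF s] \<epsilon>
      by (intro integrable_mult_right) blast
    show "lin \<epsilon> \<in> borel_measurable lborel"
      using linm by simp
    have "norm (lin \<epsilon> y) \<le> norm (\<rho> * norm b * (?I \<epsilon> y / norm (x - y) powr (real CARD('n) + 2 * s)))" for y
    proof (cases "y \<in> ball x \<rho> - ball x \<epsilon>")
      case True
      have "\<bar>(y - x) \<bullet> b\<bar> \<le> norm (y - x) * norm b"
        by (rule Cauchy_Schwarz_ineq2)
      also have "\<dots> \<le> \<rho> * norm b"
        using True by (intro mult_right_mono) (auto simp: dist_norm norm_minus_commute)
      finally show ?thesis
        using True \<rho> by (simp add: lin_def abs_mult divide_right_mono)
    qed (auto simp: lin_def)
    then show "AE y in lborel. norm (lin \<epsilon> y)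
        \<le> norm (\<rho> * norm b * (?I \<epsilon> y / norm (x - y) powr (real CARD('n) + 2 * s)))"
      by simp
  qed
  have trunc: "(\<integral>y. ?I \<epsilon> y * frac_diff s w x y \<partial>lborel) \<le> integral\<^sup>L lborel P - integral\<^sup>L lborel N"
    if \<epsilon>: "0 < \<epsilon>" "\<epsilon> < \<rho>" for \<epsilon>
  proof -
    have "?I \<epsilon> y * frac_diff s w x y \<le> lin \<epsilon> y + (P y - N y)" for y
    proof (cases "y \<in> ball x \<epsilon>")
      case True
      then have "N y = 0"
        using N \<epsilon> by auto
      then show ?thesis
        using P[of y] True by (simp add: lin_def)
    next
      case False
      then show ?thesis
        using le[of y] by (simp add: lin_def)
    qed
    then have "(\<integral>y. ?I \<epsilon> y * frac_diff s w x y \<partial>lborel) \<le> (\<integral>y. lin \<epsilon> y + (P y - N y) \<partial>lborel)"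
      using L[unfolded has_frac_laplacian_lborel[OF w]] linint[OF \<epsilon>(1)] int \<epsilon>(1)
      by (intro integral_mono) auto
    also have "\<dots> = integral\<^sup>L lborel P - integral\<^sup>L lborel N"
      using linint[OF \<epsilon>(1)] int by (simp add: lin0)
    finally show ?thesis .
  qed
  have "eventually (\<lambda>\<epsilon>. 0 < \<epsilon> \<and> \<epsilon> < \<rho>) (at_right 0)"
    using \<rho> by (auto simp: eventually_at_right_field)
  then have "eventually (\<lambda>\<epsilon>. ?c * (\<integral>y. ?I \<epsilon> y * frac_diff s w x y \<partial>lborel)
      \<le> ?c * (integral\<^sup>L lborel P - integral\<^sup>L lborel N)) (at_right 0)"
    by eventually_elim (use trunc c in auto)
  then show ?thesis
    using L[unfolded has_frac_laplacian_lborel[OF w]]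
    by (intro tendsto_upperbound[OF conjunct2]) auto
qed

section \<open>Touching by a paraboloid\<close>

text \<open>
  The iterated \<^const>\<open>deriv\<close> behind \<^const>\<open>laplacian\<close> is a genuine second derivative because the first
  partial derivative agrees with the Frechet derivative in a whole neighbourhood of \<open>x\<close>.
\<close>

lemma C2_on_second_derivative:
  fixes u :: "real^'n::finite \<Rightarrow> real"
  assumes "C2_on S u" and S: "open S" and x: "x \<in> S"
  shows "\<forall>\<^sub>F t in nhds 0. ((\<lambda>t. u (x + t *\<^sub>R axis i 1)) has_real_derivative
            partial_deriv i u (x + t *\<^sub>R axis i 1)) (at t)"
    and "((\<lambda>t. partial_deriv i u (x + t *\<^sub>R axis i 1)) has_real_derivative
            partial_deriv i (partial_deriv i u) x) (at 0)"
proof -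
  let ?e = "axis i 1 :: real^'n"
  obtain D :: "real^'n \<Rightarrow> (real^'n) \<Rightarrow>\<^sub>L real"
    and D2 :: "real^'n \<Rightarrow> (real^'n) \<Rightarrow>\<^sub>L (real^'n) \<Rightarrow>\<^sub>L real"
    where D: "\<And>x. x \<in> S \<Longrightarrow> (u has_derivative blinfun_apply (D x)) (at x)"
      and D2: "\<And>x. x \<in> S \<Longrightarrow> (D has_derivative blinfun_apply (D2 x)) (at x)"
    using assms(1) unfolding C2_on_def by blast
  have line: "((\<lambda>t. u (z + t *\<^sub>R ?e)) has_real_derivative D (z + t *\<^sub>R ?e) ?e) (at t)"
    if "z + t *\<^sub>R ?e \<in> S" for z t
  proof -
    have "((\<lambda>t. u (z + t *\<^sub>R ?e)) has_derivative (\<lambda>h. D (z + t *\<^sub>R ?e) (h *\<^sub>R ?e))) (at t)"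
      by (rule has_derivative_compose[where f = "\<lambda>t. z + t *\<^sub>R ?e", OF _ D[OF that]])
        (auto intro!: derivative_eq_intros)
    then show ?thesis
      by (simp add: has_field_derivative_def blinfun.scaleR_right mult.commute[of _ "D _ _"])
  qed
  have pd: "partial_deriv i u z = D z ?e" if "z \<in> S" for z
    unfolding partial_deriv_def using line[of z 0] that by (intro DERIV_imp_deriv) simp
  have near: "\<forall>\<^sub>F t in nhds 0. x + t *\<^sub>R ?e \<in> S"
  proof -
    have "((\<lambda>t. x + t *\<^sub>R ?e) \<longlongrightarrow> x + 0 *\<^sub>R ?e) (nhds 0)"
      by (intro tendsto_intros filterlim_ident)
    then show ?thesis
      using S x by (auto simp: tendsto_def)
  qed
  show "\<forall>\<^sub>F t in nhds 0. ((\<lambda>t. u (x + t *\<^sub>R ?e)) has_real_derivative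
            partial_deriv i u (x + t *\<^sub>R ?e)) (at t)"
    using near by eventually_elim (simp add: pd line)
  have "((\<lambda>t. D (x + t *\<^sub>R ?e)) has_derivative (\<lambda>h. D2 x (h *\<^sub>R ?e))) (at 0)"
    by (rule has_derivative_compose[where f = "\<lambda>t. x + t *\<^sub>R ?e" and g = D])
      (use D2[OF x] in \<open>auto intro!: derivative_eq_intros\<close>)
  then have "((\<lambda>t. blinfun_apply (D (x + t *\<^sub>R ?e)) ?e) has_derivative
      (\<lambda>h. blinfun_apply (D2 x (h *\<^sub>R ?e)) ?e)) (at 0)"
    by (rule bounded_linear.has_derivative[OF blinfun.bounded_linear_left])
  then have "((\<lambda>t. blinfun_apply (D (x + t *\<^sub>R ?e)) ?e) has_real_derivative D2 x ?e ?e) (at 0)"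
    by (simp add: has_field_derivative_def blinfun.scaleR_right blinfun.scaleR_left mult_commute_abs)
  then have d2: "((\<lambda>t. partial_deriv i u (x + t *\<^sub>R ?e)) has_real_derivative D2 x ?e ?e) (at 0)"
    by (rule DERIV_cong_ev[THEN iffD1, rotated -1])
       (use near in \<open>auto elim!: eventually_mono simp: pd\<close>)
  then have "partial_deriv i (partial_deriv i u) x = D2 x ?e ?e"
    unfolding partial_deriv_def[of i "partial_deriv i u"] by (rule DERIV_imp_deriv)
  then show "((\<lambda>t. partial_deriv i u (x + t *\<^sub>R ?e)) has_real_derivative
            partial_deriv i (partial_deriv i u) x) (at 0)"
    using d2 by simp
qed

text \<open>
  If \<open>l < 0\<close> then \<open>f'\<close>, which vanishes at \<open>0\<close>, is negative just to the right of \<open>0\<close>, and the mean value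
  theorem makes \<open>f\<close> smaller there than at \<open>0\<close>.
\<close>

lemma second_derivative_nonneg_at_minimum:
  fixes f f' :: "real \<Rightarrow> real"
  assumes f: "\<forall>\<^sub>F t in nhds 0. (f has_real_derivative f' t) (at t)"
    and f': "(f' has_real_derivative l) (at 0)"
    and min: "\<And>t. f 0 \<le> f t"
  shows "0 \<le> l"
proof (rule ccontr)
  assume "\<not> 0 \<le> l"
  then obtain d where d: "0 < d" "\<And>h. 0 < h \<Longrightarrow> h < d \<Longrightarrow> f' h < f' 0"
    using DERIV_neg_dec_right[OF f'] by auto
  obtain r where r: "0 < r" "\<And>t. \<bar>t\<bar> < r \<Longrightarrow> (f has_real_derivative f' t) (at t)"
    using f unfolding eventually_nhds_metric dist_real_def by auto
  have "f' 0 = 0"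
    using r min by (intro DERIV_local_min[of f _ 0 1]) auto
  define h where "h = min d r / 2"
  have h: "0 < h" "h < d" "h < r"
    using d r by (auto simp: h_def)
  have "\<exists>z>0. z < h \<and> f h - f 0 = (h - 0) * f' z"
    by (rule MVT2) (use h r in auto)
  then obtain z where "0 < z" "z < h" "f h - f 0 = h * f' z"
    by auto
  then show False
    using d(2)[of z] h min[of h] \<open>f' 0 = 0\<close> mult_pos_neg[of h "f' z"] by auto
qed

text \<open>
  At a minimum of \<open>w + \<delta> * (norm (y - p))\<^sup>2\<close>, with \<open>w\<close> the increment of \<open>u\<close> along \<open>c\<close>, every pure second
  derivative is nonnegative, and the paraboloid contributes \<open>2 * \<delta>\<close> to each of them.
\<close>

lemma laplacian_diff_at_touching_paraboloid:
  fixes u :: "real^'n::finite \<Rightarrow> real" and \<delta> :: real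
  assumes u: "C2_on S u" "open S" "x \<in> S" "c + x \<in> S"
    and min: "\<And>y. u (c + x) - u x + \<delta> * (norm (x - p))\<^sup>2 \<le> u (c + y) - u y + \<delta> * (norm (y - p))\<^sup>2"
  shows "- 2 * real CARD('n) * \<delta> \<le> laplacian u (c + x) - laplacian u x"
proof -
  have *: "- 2 * \<delta> \<le> partial_deriv i (partial_deriv i u) (c + x) - partial_deriv i (partial_deriv i u) x" for i
  proof -
    let ?e = "axis i 1 :: real^'n"
    define \<phi> where "\<phi> = (\<lambda>t. u (c + x + t *\<^sub>R ?e) - u (x + t *\<^sub>R ?e) + \<delta> * (norm (x + t *\<^sub>R ?e - p))\<^sup>2)"
    define \<phi>' where "\<phi>' = (\<lambda>t. partial_deriv i u (c + x + t *\<^sub>R ?e) - partial_deriv i u (x + t *\<^sub>R ?e)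
        + \<delta> * (2 * (x - p) $ i + 2 * t))"
    have e1: "?e \<bullet> ?e = 1"
      by (simp add: inner_axis_axis)
    have sq: "(norm (x + t *\<^sub>R ?e - p))\<^sup>2 = (norm (x - p))\<^sup>2 + 2 * t * (x - p) $ i + t\<^sup>2" for t
    proof -
      have "x + t *\<^sub>R ?e - p = (x - p) + t *\<^sub>R ?e"
        by simp
      then have "(norm (x + t *\<^sub>R ?e - p))\<^sup>2 = (norm (x - p))\<^sup>2 + 2 * (t * ((x - p) \<bullet> ?e)) + t\<^sup>2 * (?e \<bullet> ?e)"
        by (simp only: power2_norm_eq_inner inner_add_left inner_add_right inner_scaleR_left
            inner_scaleR_right inner_commute[of ?e "x - p"]) (simp add: power2_eq_square distrib_left)
      then show ?thesis
        by (simp add: e1 inner_axis)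
    qed
    note d = C2_on_second_derivative[OF u(1,2), of _ i]
    have "\<forall>\<^sub>F t in nhds 0. (\<phi> has_real_derivative \<phi>' t) (at t)"
      using d(1)[OF u(3)] d(1)[OF u(4)]
      by eventually_elim (auto simp: \<phi>_def \<phi>'_def sq intro!: derivative_eq_intros)
    moreover have "(\<phi>' has_real_derivative
        partial_deriv i (partial_deriv i u) (c + x) - partial_deriv i (partial_deriv i u) x + 2 * \<delta>) (at 0)"
      unfolding \<phi>'_def by (auto intro!: derivative_eq_intros d(2) u)
    moreover have "\<phi> 0 \<le> \<phi> t" for t
      using min[of "x + t *\<^sub>R ?e"] by (simp add: \<phi>_def add.assoc)
    ultimately show ?thesis
      using second_derivative_nonneg_at_minimum by fastforce
  qed
  have "(\<Sum>i\<in>(UNIV::'n set). - 2 * \<delta>) \<le> (\<Sum>i\<in>UNIV. partial_deriv i (partial_deriv i u) (c + x)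
      - partial_deriv i (partial_deriv i u) x)"
    by (intro sum_mono *)
  then show ?thesis
    by (simp add: laplacian_def sum_subtractf)
qed

text \<open>
  A continuous function that is bounded below need not attain its infimum, but it does so after
  adding a small paraboloid centred at an almost minimal point \<open>p\<close>. On the sphere of radius \<open>R\<close> about
  \<open>p\<close> the paraboloid equals \<open>\<eta>\<close>, more than the excess of \<open>w p\<close> over the lower bound; hence the minimum over
  the ball is a global one, and its position is known up to the distance \<open>R\<close>.
\<close>

lemma perturbed_minimum:
  fixes w :: "'a::euclidean_space \<Rightarrow> real"
  assumes cont: "continuous_on UNIV w" and low: "\<And>y. m \<le> w y"
    and p: "w p < m + \<eta>" and R: "0 < R"
  shows "\<exists>x. dist p x < R \<and> w x \<le> w p \<and>
           (\<forall>y. w x + \<eta> / R\<^sup>2 * (norm (x - p))\<^sup>2 \<le> w y + \<eta> / R\<^sup>2 * (norm (y - p))\<^sup>2)"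
proof -
  define f where "f = (\<lambda>y. w y + \<eta> / R\<^sup>2 * (norm (y - p))\<^sup>2)"
  have \<eta>: "0 < \<eta>"
    using low[of p] p by simp
  have far: "m + \<eta> \<le> f y" if "R \<le> dist p y" for y
  proof -
    have "R\<^sup>2 \<le> (norm (y - p))\<^sup>2"
      using that R by (intro power_mono) (auto simp: dist_norm norm_minus_commute)
    then have "\<eta> / R\<^sup>2 * R\<^sup>2 \<le> \<eta> / R\<^sup>2 * (norm (y - p))\<^sup>2"
      using \<eta> by (intro mult_left_mono) auto
    then show ?thesis
      using low[of y] R by (simp add: f_def)
  qed
  have "continuous_on (cball p R) f"
    unfolding f_def by (intro continuous_intros continuous_on_subset[OF cont]) auto
  then obtain x where x: "x \<in> cball p R" "\<And>y. y \<in> cball p R \<Longrightarrow> f x \<le> f y"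
    using continuous_attains_inf[of "cball p R" f] R by auto
  have fp: "f p = w p"
    by (simp add: f_def)
  have xp: "f x \<le> w p"
    using x(2)[of p] R fp by simp
  have "f x \<le> f y" for y
    using x(2)[of y] far[of y] xp p by (cases "dist p y \<le> R") auto
  moreover have "dist p x < R"
    using far[of x] xp p by (cases "R \<le> dist p x") auto
  moreover have "w x \<le> w p"
  proof -
    have "0 \<le> \<eta> / R\<^sup>2 * (norm (x - p))\<^sup>2"
      using \<eta> by simp
    then show ?thesis
      using xp by (simp add: f_def)
  qed
  ultimately show ?thesis
    by (auto simp: f_def)
qed

section \<open>Comparison at a perturbed minimum\<close>

lemma integral_const_on_ball:
  fixes z :: "'a::euclidean_space"
  assumes "0 \<le> r"
  shows "integrable lborel (\<lambda>y. a * indicator (ball z r) y)"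
    and "(\<integral>y. a * indicator (ball z r) y \<partial>lborel) = a * (unit_ball_vol DIM('a) * r ^ DIM('a))"
  using assms by (auto simp: emeasure_ball content_ball intro!: integrable_mult_right)

text \<open>
  The quantitative heart of the maximum principle. Suppose \<open>w\<close> plus a paraboloid of height \<open>\<eta>\<close> at
  scale \<open>d\<close> is minimal at \<open>x\<close>, and \<open>w\<close> exceeds \<open>w x\<close> by at least \<open>M\<close> on a ball whose size and distance
  from \<open>x\<close> are both of order \<open>d\<close>. Near \<open>x\<close> the paraboloid bounds the integrand from above, far away
  \<open>\<eta>\<close> does, and the ball contributes a negative amount proportional to \<open>M\<close>. By scaling all three
  contributions are multiples of \<open>d powr (- 2 * s)\<close>, with constants that depend on the dimension and
  \<open>s\<close> only; this uniformity in \<open>x\<close> and \<open>d\<close> is what makes the estimate usable near infinity.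
\<close>

lemma frac_laplacian_le_at_perturbed_minimum:
  fixes s :: real
  assumes s: "0 < s" "s < 1"
  obtains A C where "0 < A" and "0 < C" and
    "\<And>(w::real^'n::finite \<Rightarrow> real) x p z L d \<eta> M.
       \<lbrakk>w \<in> borel_measurable borel; has_frac_laplacian s w x L; 0 < d; 0 \<le> \<eta>; 0 \<le> M;
        \<And>y. w x - w y \<le> \<eta> / d\<^sup>2 * ((norm (y - p))\<^sup>2 - (norm (x - p))\<^sup>2);
        \<And>y. w x - w y \<le> \<eta>;
        dist x z = 2 * d; \<And>y. y \<in> ball z d \<Longrightarrow> w x - w y \<le> - M\<rbrakk>
       \<Longrightarrow> L \<le> (C * \<eta> - A * M) * d powr (- 2 * s)"
proof -
  let ?n = "CARD('n)"
  let ?p = "real ?n + 2 * s"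
  define c where "c = frac_laplacian_const ?n s"
  have c: "0 < c"
    using s by (simp add: c_def frac_laplacian_const_pos)
  obtain C1 where C1: "0 < C1" and out: "\<And>(x::real^'n) \<rho>. 0 < \<rho> \<Longrightarrow>
     integrable lborel (\<lambda>y. indicator (- ball x \<rho>) y / norm (x - y) powr ?p) \<and>
     (\<integral>y. indicator (- ball x \<rho>) y / norm (x - y) powr ?p \<partial>lborel) \<le> C1 * \<rho> powr (- 2 * s)"
    using kernel_integral_outside_ball[OF s(1)] by blast
  obtain C2 where C2: "0 < C2" and inn: "\<And>(x::real^'n) \<rho>. 0 < \<rho> \<Longrightarrow>
     integrable lborel (\<lambda>y. indicator (ball x \<rho>) y * (norm (x - y))\<^sup>2 / norm (x - y) powr ?p) \<and>
     (\<integral>y. indicator (ball x \<rho>) y * (norm (x - y))\<^sup>2 / norm (x - y) powr ?p \<partial>lborel)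
       \<le> C2 * \<rho> powr (2 - 2 * s)"
    using kernel_integral_inside_ball[OF s] by blast
  define A where "A = c * (unit_ball_vol ?n * 3 powr (- ?p))"
  define C where "C = c * (C1 + C2)"
  have A: "0 < A" and C: "0 < C"
    using c C1 C2 by (auto simp: A_def C_def intro!: mult_pos_pos)
  have main: "L \<le> (C * \<eta> - A * M) * d powr (- 2 * s)"
    if w: "w \<in> borel_measurable borel" and L: "has_frac_laplacian s w x L"
      and d: "0 < d" and \<eta>: "0 \<le> \<eta>" and M: "0 \<le> M"
      and quad: "\<And>y. w x - w y \<le> \<eta> / d\<^sup>2 * ((norm (y - p))\<^sup>2 - (norm (x - p))\<^sup>2)"
      and far: "\<And>y. w x - w y \<le> \<eta>"
      and z: "dist x z = 2 * d" and gain: "\<And>y. y \<in> ball z d \<Longrightarrow> w x - w y \<le> - M"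
    for w :: "real^'n \<Rightarrow> real" and x p z L d \<eta> M
  proof -
    define P1 where "P1 = (\<lambda>y. indicator (ball x d) y * (norm (x - y))\<^sup>2 / norm (x - y) powr ?p)"
    define P2 where "P2 = (\<lambda>y. indicator (- ball x d) y / norm (x - y) powr ?p)"
    \<comment> \<open>points of \<open>ball z d\<close> are at distance at most \<open>3 * d\<close> from \<open>x\<close>, which bounds the kernel below\<close>
    define a where "a = M / (3 * d) powr ?p"
    \<comment> \<open>\<open>b\<close> is the gradient at \<open>x\<close> of the paraboloid, the linear part of its Taylor expansion there\<close>
    define b where "b = (2 * \<eta> / d\<^sup>2) *\<^sub>R (x - p)"
    let ?N = "\<lambda>y. a * indicator (ball z d) y"
    let ?P = "\<lambda>y. \<eta> / d\<^sup>2 * P1 y + \<eta> * P2 y"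
    have int: "integrable lborel P1" "integrable lborel P2"
      and P1: "integral\<^sup>L lborel P1 \<le> C2 * d powr (2 - 2 * s)"
      and P2: "integral\<^sup>L lborel P2 \<le> C1 * d powr (- 2 * s)"
      using inn[OF d, of x] out[OF d, of x] by (auto simp: P1_def P2_def)
    have intP: "integrable lborel ?P"
      using int by (intro Bochner_Integration.integrable_add integrable_mult_right)
    have posP: "0 \<le> ?P y" for y
      using \<eta> by (simp add: P1_def P2_def)
    have intN: "integrable lborel ?N"
      using d by (intro integral_const_on_ball(1)) simp
    have disj: "dist x y < d \<Longrightarrow> \<not> dist z y < d" for y
      using z dist_triangle2[of x z y] by auto
    have NN: "integral\<^sup>L lborel ?N = M * (unit_ball_vol ?n * 3 powr (- ?p)) * d powr (- 2 * s)"
    proof -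
      have "a = M * (3 * d) powr (- ?p)"
        unfolding a_def powr_minus_divide by simp
      also have "(3 * d) powr (- ?p) = 3 powr (- ?p) * d powr (- ?p)"
        using d by (intro powr_mult)
      finally have "a * d ^ ?n = M * 3 powr (- ?p) * (d powr (- ?p) * d powr ?n)"
        using d by (simp add: powr_realpow mult_ac)
      also have "d powr (- ?p) * d powr ?n = d powr (- 2 * s)"
        by (simp add: powr_add[symmetric])
      finally have ad: "a * d ^ ?n = M * 3 powr (- ?p) * d powr (- 2 * s)" .
      have "a * (unit_ball_vol ?n * d ^ ?n) = unit_ball_vol ?n * (a * d ^ ?n)"
        by simp
      then have "a * (unit_ball_vol ?n * d ^ ?n) = M * (unit_ball_vol ?n * 3 powr (- ?p)) * d powr (- 2 * s)"
        unfolding ad by (simp only: mult_ac)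
      then show ?thesis
        by (simp only: integral_const_on_ball(2)[OF less_imp_le[OF d]] DIM_cart DIM_real mult_1_right)
    qed
    have PP: "integral\<^sup>L lborel ?P \<le> \<eta> * C2 * d powr (- 2 * s) + \<eta> * C1 * d powr (- 2 * s)"
    proof -
      have "d powr (2 - 2 * s) = d powr (2 + (- 2 * s))"
        by simp
      also have "\<dots> = d powr 2 * d powr (- 2 * s)"
        by (rule powr_add)
      also have "d powr 2 = d\<^sup>2"
        using d powr_realpow[of d 2] by simp
      finally have "\<eta> / d\<^sup>2 * integral\<^sup>L lborel P1 \<le> \<eta> / d\<^sup>2 * (C2 * (d\<^sup>2 * d powr (- 2 * s)))"
        using P1 \<eta> by (intro mult_left_mono) auto
      moreover have "\<eta> / d\<^sup>2 * (C2 * (d\<^sup>2 * d powr (- 2 * s))) = \<eta> * C2 * d powr (- 2 * s)"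
        using d by simp
      moreover have "\<eta> * integral\<^sup>L lborel P2 \<le> \<eta> * (C1 * d powr (- 2 * s))"
        using P2 \<eta> by (intro mult_left_mono) auto
      moreover have "integral\<^sup>L lborel ?P = \<eta> / d\<^sup>2 * integral\<^sup>L lborel P1 + \<eta> * integral\<^sup>L lborel P2"
        using int by simp
      ultimately show ?thesis
        by simp
    qed
    have "frac_diff s w x y \<le> indicator (ball x d) y * ((y - x) \<bullet> b) / norm (x - y) powr ?p + ?P y - ?N y"
      for y
    proof -
      consider "y \<in> ball x d" | "y \<notin> ball x d" "y \<in> ball z d" | "y \<notin> ball x d" "y \<notin> ball z d"
        by blast
      then show ?thesis
      proof cases
        case 1
        have "y - p = (y - x) + (x - p)"
          by simp
        then have "(norm (y - p))\<^sup>2 - (norm (x - p))\<^sup>2 = (norm (y - x))\<^sup>2 + 2 * ((y - x) \<bullet> (x - p))"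
          by (simp only: power2_norm_eq_inner inner_add_left inner_add_right inner_commute[of "x - p" "y - x"])
        then have "w x - w y \<le> \<eta> / d\<^sup>2 * ((norm (y - x))\<^sup>2 + 2 * ((y - x) \<bullet> (x - p)))"
          using quad[of y] by simp
        also have "\<dots> = (y - x) \<bullet> b + \<eta> / d\<^sup>2 * (norm (x - y))\<^sup>2"
          unfolding b_def inner_scaleR_right norm_minus_commute[of y x]
          by (simp add: distrib_left mult_ac)
        finally have "frac_diff s w x y \<le> ((y - x) \<bullet> b + \<eta> / d\<^sup>2 * (norm (x - y))\<^sup>2) / norm (x - y) powr ?p"
          unfolding frac_diff_def by (intro divide_right_mono) auto
        also have "\<dots> = (y - x) \<bullet> b / norm (x - y) powr ?p + ?P y - ?N y"
          using 1 disj[of y] by (simp add: P1_def P2_def add_divide_distrib)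
        finally show ?thesis
          using 1 by simp
      next
        case 2
        have "norm (x - y) \<le> 3 * d"
          using 2 z dist_triangle[of x y z] by (auto simp: dist_norm)
        moreover have "0 < norm (x - y)"
          using 2 d by (auto simp: dist_norm)
        ultimately have "a \<le> M / norm (x - y) powr ?p"
          unfolding a_def using M s d by (intro divide_left_mono powr_mono2 mult_pos_pos) auto
        moreover have "frac_diff s w x y \<le> (- M) / norm (x - y) powr ?p"
          unfolding frac_diff_def using gain[OF 2(2)] by (intro divide_right_mono) auto
        moreover have "0 \<le> \<eta> * P2 y"
          using \<eta> by (simp add: P2_def)
        ultimately show ?thesis
          using 2 by (simp add: P1_def)
      next
        case 3
        have "frac_diff s w x y \<le> \<eta> / norm (x - y) powr ?p"
          unfolding frac_diff_def using far by (intro divide_right_mono) auto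
        then show ?thesis
          using 3 by (simp add: P1_def P2_def)
      qed
    qed
    then have "L \<le> c * (integral\<^sup>L lborel ?P - integral\<^sup>L lborel ?N)"
      unfolding c_def
      by (rule has_frac_laplacian_upper_bound[OF w L s(1) _ d intP intN posP, where b = b, rotated -1])
        (use c disj in \<open>auto simp: c_def\<close>)
    also have "\<dots> \<le> c * (\<eta> * C2 * d powr (- 2 * s) + \<eta> * C1 * d powr (- 2 * s)
        - M * (unit_ball_vol ?n * 3 powr (- ?p)) * d powr (- 2 * s))"
      using PP NN c by (intro mult_left_mono) auto
    also have "\<dots> = (C * \<eta> - A * M) * d powr (- 2 * s)"
      unfolding A_def C_def by
      (simp add: left_diff_distrib right_diff_distrib distrib_left distrib_right mult_ac)
    finally show ?thesis .
  qed
  show ?thesis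
    by (rule that[OF A C main])
qed

text \<open>
  Where the shifted function lies below \<open>u\<close>, the monotonicity of \<open>g\<close> makes the right-hand side of the
  equation for the difference nonnegative, so the fractional Laplacian of the difference is at least
  its classical Laplacian. The latter is controlled by the touching paraboloid.
\<close>

lemma shift_difference_supersolution:
  fixes u :: "real^'n::finite \<Rightarrow> real" and \<delta> :: real
  assumes g: "antimono g" and u: "u \<in> borel_measurable borel" "C2_on S u" "open S"
    and eq: "\<And>x. x \<in> S \<Longrightarrow> \<exists>L. has_frac_laplacian s u x L \<and> L - laplacian u x = g (u x)"
    and x: "x \<in> S" "c + x \<in> S"
    and neg: "u (c + x) - u x \<le> 0"
    and min: "\<And>y. u (c + x) - u x + \<delta> * (norm (x - p))\<^sup>2 \<le> u (c + y) - u y + \<delta> * (norm (y - p))\<^sup>2"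
  shows "\<exists>L. has_frac_laplacian s (\<lambda>y. u (c + y) - u y) x L \<and> - 2 * real CARD('n) * \<delta> \<le> L"
proof -
  obtain L where L: "has_frac_laplacian s u x L" "L - laplacian u x = g (u x)"
    using eq x by blast
  obtain K where K: "has_frac_laplacian s u (c + x) K" "K - laplacian u (c + x) = g (u (c + x))"
    using eq x by blast
  have m: "(\<lambda>y. u (c + y)) \<in> borel_measurable borel"
    using u(1) by measurable
  have "has_frac_laplacian s (\<lambda>y. u (c + y) - u y) x (K - L)"
    by (rule has_frac_laplacian_diff[OF m u(1) has_frac_laplacian_translate[OF u(1) K(1)] L(1)])
  moreover have "g (u x) \<le> g (u (c + x))"
    using neg by (intro antimonoD[OF g]) simp
  moreover have "- 2 * real CARD('n) * \<delta> \<le> laplacian u (c + x) - laplacian u x"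
    by (rule laplacian_diff_at_touching_paraboloid[OF u(2,3) x min])
  ultimately show ?thesis
    using L(2) K(2) by (intro exI[of _ "K - L"]) auto
qed

text \<open>
  The boundary hyperplane belongs to the complement of the half space, so the two continuous pieces
  live on closed sets and agree on their intersection.
\<close>

lemma continuous_on_UNIV_if_zero_outside_half_space:
  fixes u :: "real^'n::finite \<Rightarrow> real"
  assumes "continuous_on (closure (half_space k)) u"
    and "\<And>x. x \<notin> half_space k \<Longrightarrow> u x = 0"
  shows "continuous_on UNIV u"
proof -
  have "continuous_on ({x::real^'n. 0 \<le> x $ k} \<union> {x. x $ k \<le> 0}) u"
  proof (rule continuous_on_closed_Un)
    show "continuous_on {x. 0 \<le> x $ k} u"
      using assms(1) by (simp add: half_space_def)
    show "continuous_on {x. x $ k \<le> 0} u"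
      using assms(2) by (intro continuous_on_eq[OF continuous_on_const[of _ 0]]) (auto simp: half_space_def)
  qed (auto intro: closed_halfspace_component_le_cart closed_halfspace_component_ge_cart)
  moreover have "{x::real^'n. 0 \<le> x $ k} \<union> {x. x $ k \<le> 0} = UNIV"
    by auto
  ultimately show ?thesis
    by simp
qed

section \<open>Monotonicity\<close>

text \<open>
  A negative infimum of \<open>w\<close>, the increment of \<open>u\<close> over the shift, is excluded even if it is approached
  only at infinity. The length scale is adapted to the height of the almost minimal point \<open>p\<close> above
  the boundary: with \<open>R = max 1 (p $ k)\<close>, the perturbed minimum \<open>q\<close> sees a ball of radius \<open>2 * R\<close>, at
  distance \<open>4 * R\<close>, in the complement of the half space, where \<open>w\<close> is nonnegative. The lower bound by
  \<open>1\<close> on \<open>R\<close> lets the local term, of order \<open>\<eta> / R\<^sup>2\<close>, be absorbed by the nonlocal scale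
  \<open>R powr (- 2 * s)\<close>.
\<close>
lemma shift_difference_nonneg:
  fixes u :: "real^'n::finite \<Rightarrow> real" and g :: "real \<Rightarrow> real" and s :: real and k :: 'n
  assumes s: "0 < s" "s < 1" and g: "antimono g"
    and C2: "C2_on (half_space k) u" and cont: "continuous_on UNIV u"
    and nonneg: "\<And>x. 0 \<le> u x" and bdd: "bounded (range u)"
    and eq: "\<And>x. x \<in> half_space k \<Longrightarrow>
           \<exists>L. has_frac_laplacian s u x L \<and> L - laplacian u x = g (u x)"
    and outside: "\<And>x. x \<notin> half_space k \<Longrightarrow> u x = 0"
    and \<tau>: "0 < \<tau>"
  shows "u x \<le> u (\<tau> *\<^sub>R axis k 1 + x)"
proof (rule ccontr)
  assume neg: "\<not> ?thesis"
  let ?e = "axis k 1 :: real^'n"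
  let ?c = "\<tau> *\<^sub>R ?e"
  define w where "w = (\<lambda>y. u (?c + y) - u y)"
  have contw: "continuous_on UNIV w"
    unfolding w_def
    by (intro continuous_intros continuous_on_compose2[OF cont]) auto
  have um: "u \<in> borel_measurable borel" and wm: "w \<in> borel_measurable borel"
    using cont contw by (auto intro: borel_measurable_continuous_onI)
  have openH: "open (half_space k :: (real^'n) set)"
    unfolding half_space_def by (rule open_halfspace_component_gt_cart)
  have w_out: "0 \<le> w y" if "y $ k \<le> 0" for y
    using that nonneg outside[of y] by (simp add: w_def half_space_def)
  obtain B where B: "\<And>y. u y \<le> B"
    using bdd unfolding bounded_iff by (auto simp: abs_le_iff)
  have bdd_w: "bdd_below (range w)"
  proof (rule bdd_belowI2)
    show "- B \<le> w y" for y
      using B[of y] nonneg[of "?c + y"] by (simp add: w_def)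
  qed
  define M where "M = - (INF y. w y)"
  have low: "- M \<le> w y" for y
    unfolding M_def using bdd_w by (simp add: cINF_lower)
  have M: "0 < M"
    using low[of x] neg by (simp add: w_def)
  obtain A C where A: "0 < A" and C: "0 < C" and bound:
    "\<And>(w::real^'n \<Rightarrow> real) x p z L d \<eta> M.
       \<lbrakk>w \<in> borel_measurable borel; has_frac_laplacian s w x L; 0 < d; 0 \<le> \<eta>; 0 \<le> M;
        \<And>y. w x - w y \<le> \<eta> / d\<^sup>2 * ((norm (y - p))\<^sup>2 - (norm (x - p))\<^sup>2);
        \<And>y. w x - w y \<le> \<eta>;
        dist x z = 2 * d; \<And>y. y \<in> ball z d \<Longrightarrow> w x - w y \<le> - M\<rbrakk>
       \<Longrightarrow> L \<le> (C * \<eta> - A * M) * d powr (- 2 * s)"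
  proof -
    show thesis
      by (rule frac_laplacian_le_at_perturbed_minimum[where ?'n = 'n, OF s]) (fact that)
  qed
  define B' where "B' = 2 * real CARD('n) + C"
  have B': "0 < B'"
    using C by (simp add: B'_def)
  \<comment> \<open>small enough that the paraboloid error, with constant \<open>B'\<close>, loses against the gain\<close>
  define \<eta> where "\<eta> = min (M / 2) (A * (M / 2) / (2 * B')) / 4"
  have \<eta>: "0 < \<eta>" "\<eta> \<le> M / 2" "B' * (4 * \<eta>) < A * (M / 2)"
  proof -
    show "0 < \<eta>" "\<eta> \<le> M / 2"
      using M A B' by (auto simp: \<eta>_def)
    have "B' * (4 * \<eta>) \<le> B' * (A * (M / 2) / (2 * B'))"
      unfolding \<eta>_def using B' by (intro mult_left_mono) auto
    also have "\<dots> < A * (M / 2)"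
      using A B' M by simp
    finally show "B' * (4 * \<eta>) < A * (M / 2)" .
  qed
  have "(INF y. w y) < - M + \<eta>"
    using \<eta> by (simp add: M_def)
  then obtain p where p: "w p < - M + \<eta>"
    using cINF_less_iff[OF _ bdd_w] by auto
  define R where "R = max 1 (p $ k)"
  define d where "d = 2 * R"
  have R: "1 \<le> R"
    by (simp add: R_def)
  obtain q where q: "dist p q < R" "w q \<le> w p"
    and qmin: "\<And>y. w q + \<eta> / R\<^sup>2 * (norm (q - p))\<^sup>2 \<le> w y + \<eta> / R\<^sup>2 * (norm (y - p))\<^sup>2"
    using perturbed_minimum[OF contw low p, of R] R by auto
  have wq: "w q \<le> - (M / 2)"
    using p q \<eta> by linarith
  have qH: "q \<in> half_space k"
    using w_out[of q] wq M by (force simp: half_space_def)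
  then have cqH: "?c + q \<in> half_space k"
    using \<tau> by (simp add: half_space_def)
  have "\<exists>L. has_frac_laplacian s w q L \<and> - 2 * real CARD('n) * (\<eta> / R\<^sup>2) \<le> L"
    unfolding w_def
    by (rule shift_difference_supersolution[OF g um C2 openH eq qH cqH, where p = p])
      (use qmin wq M in \<open>auto simp: w_def\<close>)
  then obtain L where L: "has_frac_laplacian s w q L" "- 2 * real CARD('n) * (\<eta> / R\<^sup>2) \<le> L"
    by blast
  \<comment> \<open>a paraboloid of height \<open>\<eta>\<close> at scale \<open>R\<close> has height \<open>4 * \<eta>\<close> at scale \<open>d\<close>\<close>
  have scale: "\<eta> / R\<^sup>2 = 4 * \<eta> / d\<^sup>2"
    using R by (simp add: d_def power2_eq_square)
  have "L \<le> (C * (4 * \<eta>) - A * (M / 2)) * d powr (- 2 * s)"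
  proof (rule bound[OF wm L(1), where z = "q - (2 * d) *\<^sub>R ?e" and p = p])
    show "w q - w y \<le> 4 * \<eta> / d\<^sup>2 * ((norm (y - p))\<^sup>2 - (norm (q - p))\<^sup>2)" for y
      using qmin[of y] unfolding scale by (simp add: right_diff_distrib)
    show "w q - w y \<le> 4 * \<eta>" for y
      using low[of y] p q \<eta> by linarith
    show "dist q (q - (2 * d) *\<^sub>R ?e) = 2 * d"
      using R by (simp add: dist_norm d_def norm_axis_1)
    \<comment> \<open>the gain: this ball lies below the boundary, since \<open>q $ k < p $ k + R \<le> d\<close>\<close>
    show "w q - w y \<le> - (M / 2)" if "y \<in> ball (q - (2 * d) *\<^sub>R ?e) d" for y
    proof -
      have "\<bar>(y - (q - (2 * d) *\<^sub>R ?e)) $ k\<bar> < d"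
        using that component_le_norm_cart[of "y - (q - (2 * d) *\<^sub>R ?e)" k]
        by (simp add: dist_norm norm_minus_commute)
      then have "y $ k < q $ k - d"
        by simp
      moreover have "\<bar>(q - p) $ k\<bar> < R"
        using q(1) component_le_norm_cart[of "q - p" k] by (simp add: dist_norm norm_minus_commute)
      ultimately have "y $ k \<le> 0"
        by (simp add: d_def R_def)
      then show ?thesis
        using w_out wq by fastforce
    qed
  qed (use R \<eta> M in \<open>auto simp: d_def\<close>)
  moreover have "- 2 * real CARD('n) * (4 * \<eta>) * d powr (- 2 * s) \<le> L"
  proof -
    have "d powr (- 2) \<le> d powr (- 2 * s)"
      using R s by (intro powr_mono) (auto simp: d_def)
    then have "1 / d\<^sup>2 \<le> d powr (- 2 * s)"
      using R by (simp add: powr_minus_divide d_def)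
    then have "2 * real CARD('n) * (4 * \<eta>) * (1 / d\<^sup>2) \<le> 2 * real CARD('n) * (4 * \<eta>) * d powr (- 2 * s)"
      using \<eta> by (intro mult_left_mono) auto
    then show ?thesis
      using L(2) unfolding scale by simp
  qed
  ultimately have "0 \<le> (B' * (4 * \<eta>) - A * (M / 2)) * d powr (- 2 * s)"
    by (simp add: B'_def algebra_simps)
  moreover have "0 < d powr (- 2 * s)"
    using R by (simp add: d_def)
  ultimately show False
    using \<eta>(3) by (simp add: zero_le_mult_iff)
qed

text \<open>
  The strong maximum principle. At an interior zero the nonnegative increment has a minimum, so its
  fractional Laplacian there is nonnegative by the equation. This contradicts nonlocality: in the
  strip just below the boundary, of width \<open>\<tau>\<close>, \<open>u\<close> vanishes while the shifted function is positive,
  and this positive mass makes the fractional Laplacian strictly negative.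
\<close>

lemma shift_difference_pos:
  fixes u :: "real^'n::finite \<Rightarrow> real" and g :: "real \<Rightarrow> real" and s :: real and k :: 'n
  assumes s: "0 < s" "s < 1" and g: "antimono g"
    and C2: "C2_on (half_space k) u" and cont: "continuous_on UNIV u"
    and eq: "\<And>x. x \<in> half_space k \<Longrightarrow>
           \<exists>L. has_frac_laplacian s u x L \<and> L - laplacian u x = g (u x)"
    and pos: "\<And>x. x \<in> half_space k \<Longrightarrow> 0 < u x"
    and outside: "\<And>x. x \<notin> half_space k \<Longrightarrow> u x = 0"
    and \<tau>: "0 < \<tau>" and mono: "\<And>y. u y \<le> u (\<tau> *\<^sub>R axis k 1 + y)"
    and x: "x \<in> half_space k"
  shows "u x < u (\<tau> *\<^sub>R axis k 1 + x)"
proof (rule ccontr)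
  assume eq0: "\<not> ?thesis"
  let ?e = "axis k 1 :: real^'n"
  let ?c = "\<tau> *\<^sub>R ?e"
  let ?p = "real CARD('n) + 2 * s"
  define w where "w = (\<lambda>y. u (?c + y) - u y)"
  have wx: "w x = 0"
    using mono[of x] eq0 by (simp add: w_def)
  have w_nonneg: "0 \<le> w y" for y
    using mono by (simp add: w_def)
  have contw: "continuous_on UNIV w"
    unfolding w_def
    by (intro continuous_intros continuous_on_compose2[OF cont]) auto
  have um: "u \<in> borel_measurable borel" and wm: "w \<in> borel_measurable borel"
    using cont contw by (auto intro: borel_measurable_continuous_onI)
  have openH: "open (half_space k :: (real^'n) set)"
    unfolding half_space_def by (rule open_halfspace_component_gt_cart)
  have xk: "0 < x $ k"
    using x by (simp add: half_space_def)
  have cxH: "?c + x \<in> half_space k"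
    using xk \<tau> by (simp add: half_space_def)
  have "\<exists>L. has_frac_laplacian s w x L \<and> - 2 * real CARD('n) * 0 \<le> L"
    unfolding w_def
    by (rule shift_difference_supersolution[OF g um C2 openH eq x cxH, where p = 0])
      (use w_nonneg wx in \<open>auto simp: w_def\<close>)
  then obtain L where L: "has_frac_laplacian s w x L" "0 \<le> L"
    by auto
  \<comment> \<open>\<open>z\<close> lies halfway down the strip, below \<open>x\<close>; radius \<open>\<tau> / 4\<close> keeps its ball inside the strip\<close>
  define h where "h = x $ k + \<tau> / 2"
  define z where "z = x - h *\<^sub>R ?e"
  have strip: "y $ k < 0 \<and> - \<tau> < y $ k" if "y \<in> cball z (\<tau> / 4)" for y
  proof -
    have "\<bar>(y - z) $ k\<bar> \<le> \<tau> / 4"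
      using that component_le_norm_cart[of "y - z" k] by (simp add: dist_norm norm_minus_commute)
    then have "\<bar>y $ k + \<tau> / 2\<bar> \<le> \<tau> / 4"
      by (simp add: z_def h_def)
    then show ?thesis
      using \<tau> unfolding abs_le_iff by linarith
  qed
  have "\<exists>y0\<in>cball z (\<tau> / 4). \<forall>y\<in>cball z (\<tau> / 4). w y0 \<le> w y"
    using \<tau> by (intro continuous_attains_inf continuous_on_subset[OF contw]) auto
  then obtain y0 where y0: "y0 \<in> cball z (\<tau> / 4)" "\<And>y. y \<in> cball z (\<tau> / 4) \<Longrightarrow> w y0 \<le> w y"
    by blast
  have m: "0 < w y0"
    using strip[OF y0(1)] pos[of "?c + y0"] outside[of y0] by (simp add: w_def half_space_def)
  define a where "a = w y0 / (h + \<tau> / 4) powr ?p"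
  have a: "0 < a"
    using m \<tau> xk by (simp add: a_def h_def)
  have dxz: "dist x z = h"
    using \<tau> xk by (simp add: dist_norm z_def h_def norm_axis_1)
  have disj: "dist x y < x $ k \<Longrightarrow> \<not> dist z y < \<tau> / 4" for y
    using dxz dist_triangle2[of x z y] \<tau> by (auto simp: h_def)
  have int: "integrable lborel (\<lambda>y. a * indicator (ball z (\<tau> / 4)) y)"
    using \<tau> by (intro integral_const_on_ball(1)) simp
  have c: "0 < frac_laplacian_const CARD('n) s"
    using s by (simp add: frac_laplacian_const_pos)
  have "frac_diff s w x y \<le> indicator (ball x (x $ k)) y * ((y - x) \<bullet> 0) / norm (x - y) powr ?p
      + 0 - a * indicator (ball z (\<tau> / 4)) y" for y
  proof (cases "y \<in> ball z (\<tau> / 4)")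
    case True
    have "norm (x - y) \<le> h + \<tau> / 4"
      using True dxz dist_triangle[of x y z] by (auto simp: dist_norm)
    moreover have "0 < norm (x - y)"
      using True disj[of y] xk by auto
    ultimately have "a \<le> w y0 / norm (x - y) powr ?p"
      unfolding a_def using m s \<tau> xk
      by (intro divide_left_mono powr_mono2 mult_pos_pos) (auto simp: h_def)
    also have "\<dots> \<le> w y / norm (x - y) powr ?p"
      using y0(2)[of y] True by (intro divide_right_mono) auto
    finally show ?thesis
      using True wx by (simp add: frac_diff_def)
  next
    case False
    then show ?thesis
      using w_nonneg[of y] wx by (simp add: frac_diff_def)
  qed
  then have "L \<le> frac_laplacian_const CARD('n) s
      * ((\<integral>y. 0 \<partial>(lborel::(real^'n) measure)) - (\<integral>y. a * indicator (ball z (\<tau> / 4)) y \<partial>lborel))"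
    by (rule has_frac_laplacian_upper_bound[OF wm L(1) s(1) c xk _ int, rotated -1])
      (use disj in auto)
  also have "\<dots> = - (frac_laplacian_const CARD('n) s * (a * (unit_ball_vol (real CARD('n)) * (\<tau> / 4) ^ CARD('n))))"
    using integral_const_on_ball(2)[of "\<tau> / 4" a z] \<tau> by simp
  also have "\<dots> < 0"
    using c a \<tau> by simp
  finally show False
    using L(2) by simp
qed

theorem theorem1p4:
  fixes u :: "real^'n::finite \<Rightarrow> real" and g :: "real \<Rightarrow> real" and s :: real and k :: 'n
  assumes "0 < s" and "s < 1"
    and "continuous_on UNIV g" and "antimono g"
    and "u \<in> L2s_space s"
    and "C2_on (half_space k) u"
    and "continuous_on (closure (half_space k)) u"
    and "\<And>x. 0 \<le> u x"
    and "bounded (range u)"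
    and "\<And>x. x \<in> half_space k \<Longrightarrow>
           \<exists>L. has_frac_laplacian s u x L \<and> L - laplacian u x = g (u x)"
    and "\<And>x. x \<in> half_space k \<Longrightarrow> 0 < u x"
    and "\<And>x. x \<notin> half_space k \<Longrightarrow> u x = 0"
  shows "\<forall>x\<in>half_space k. \<forall>y\<in>half_space k.
           (\<forall>i. i \<noteq> k \<longrightarrow> x $ i = y $ i) \<and> x $ k < y $ k \<longrightarrow> u x < u y"
proof (intro ballI impI)
  fix x y :: "real^'n"
  assume x: "x \<in> half_space k" and xy: "(\<forall>i. i \<noteq> k \<longrightarrow> x $ i = y $ i) \<and> x $ k < y $ k"
  have cont: "continuous_on UNIV u"
    by (rule continuous_on_UNIV_if_zero_outside_half_space[OF assms(7,12)])
  define \<tau> where "\<tau> = y $ k - x $ k"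
  have \<tau>: "0 < \<tau>"
    using xy by (simp add: \<tau>_def)
  have y: "y = \<tau> *\<^sub>R axis k 1 + x"
    using xy by (auto simp: vec_eq_iff \<tau>_def axis_def)
  have mono: "u z \<le> u (\<tau> *\<^sub>R axis k 1 + z)" for z
    by (rule shift_difference_nonneg[OF assms(1,2,4,6) cont assms(8,9,10,12) \<tau>])
  show "u x < u y"
    unfolding y by (rule shift_difference_pos[OF assms(1,2,4,6) cont assms(10,11,12) \<tau> mono x])
qed

end
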